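(* Let $(\Omega,\mathcal{H},\hat{\mathbb{E}})$ be a regular sublinear expectation space with representing set of probability measures $\mathcal{P}$ and upper capacity $\hat V$. Let $n,d\ge 1$ and let $\{X_i\}_{i=1}^n\subset L^2(\Omega;\mathbb{R}^d)$ be independent under $\hat{\mathbb{E}}$ with $|X_i|\le M$ a.s. for all $i\le n$, where $M>0$ is a constant. Then for every $t>0$, \[ \hat V\!\left(\rho_\Theta\!\left(\frac1n\sum_{i=1}^n X_i\right)>t\right)\le 2\cdot 5^d\,\exp\!\left(-\frac{nt^2}{32M^2}\right). \]
   Context: $\Omega$ is a complete separable metric space and $\mathcal{H}=C_{b.\mathrm{Lip}}(\Omega)$ is the space of bounded Lipschitz real functions on $\Omega$. A regular sublinear expectation is a functional $\hat{\mathbb{E}}:\mathcal{H}\to\mathbb{R}$ that is monotone, constant preserving, subadditive and positively homogeneous, and such that $X_k\in\mathcal{H}$, $X_k\downarrow 0$ implies $\hat{\mathbb{E}}[X_k]\downarrow 0$. By a known representation theorem there is a convex, weakly compact set $\mathcal{P}$ of probability measures on $(\Omega,\mathcal{B}(\Omega))$ with $\hat{\mathbb{E}}[X]=\sup_{P\in\mathcal{P}}E_P[X]$ for $X\in\mathcal{H}$; fix this $\mathcal{P}$. The upper capacity is $\hat V(A)=\sup_{P\in\mathcal{P}}P(A)$. $L^p(\Omega)$ is the completion of $\mathcal{H}$ under $\|X\|_p=(\hat{\mathbb{E}}[|X|^p])^{1/p}$, and $L^p(\Omega;\mathbb{R}^d)$ denotes $\mathbb{R}^d$-valued vectors with components in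 $L^p(\Omega)$; $\hat{\mathbb{E}}$ and the representation extend to $L^1(\Omega)$. "a.s." without a specified measure means $P$-a.s. for every $P\in\mathcal{P}$. Independence: $\{X_i\}_{i=1}^n\subset L^1(\Omega;\mathbb{R}^d)$ is independent under $\hat{\mathbb{E}}$ if for each $1\le i\le n-1$ and every $\psi\in C_{b.\mathrm{Lip}}(\mathbb{R}^{d(i+1)})$, $\hat{\mathbb{E}}[\psi(X_1,\dots,X_i,X_{i+1})]=\hat{\mathbb{E}}\big[\hat{\mathbb{E}}[\psi(x_1,\dots,x_i,X_{i+1})]\big|_{(x_1,\dots,x_i)=(X_1,\dots,X_i)}\big]$. $|\cdot|$ and $\langle\cdot,\cdot\rangle$ are the Euclidean norm and inner product. For each $i$, $\Theta_i=\{\theta\in\mathbb{R}^d:\langle\theta,p\rangle\le\hat{\mathbb{E}}[\langle p,X_i\rangle]\ \forall p\in\mathbb{R}^d\}$, a convex compact set, known to equal $\{E_P[X_i]:P\in\mathcal{P}\}$ for independent $X_i$ in $L^2$. Further, $\Theta=\{\frac1n\sum_{i=1}^n\theta_i:\theta_i\in\Theta_i\}$ and $\rho_\Theta(x)=\inf_{\theta\in\Theta}|x-\theta|$. *)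

theory Defs
  imports "HOL-Probability.Probability"
begin

definition bLip :: "('w::metric_space \<Rightarrow> real) set" where
  "bLip = {X. bounded (range X) \<and> (\<exists>C. C-lipschitz_on UNIV X)}"

definition regular_sublinear_expectation :: "(('w::metric_space \<Rightarrow> real) \<Rightarrow> real) \<Rightarrow> bool" where
  "regular_sublinear_expectation E \<longleftrightarrow>
     (\<forall>X\<in>bLip. \<forall>Y\<in>bLip. (\<forall>\<omega>. X \<omega> \<le> Y \<omega>) \<longrightarrow> E X \<le> E Y) \<and>
     (\<forall>c. E (\<lambda>\<omega>. c) = c) \<and>
     (\<forall>X\<in>bLip. \<forall>Y\<in>bLip. E (\<lambda>\<omega>. X \<omega> + Y \<omega>) \<le> E X + E Y) \<and>
     (\<forall>X\<in>bLip. \<forall>c\<ge>0. E (\<lambda>\<omega>. c * X \<omega>) = c * E X) \<and>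
     (\<forall>X :: nat \<Rightarrow> 'w \<Rightarrow> real.
        (\<forall>k. X k \<in> bLip) \<and> (\<forall>\<omega>. decseq (\<lambda>k. X k \<omega>) \<and> (\<lambda>k. X k \<omega>) \<longlonglongrightarrow> 0) \<longrightarrow>
        decseq (\<lambda>k. E (X k)) \<and> (\<lambda>k. E (X k)) \<longlonglongrightarrow> 0)"

definition borel_probs :: "'w::topological_space measure set" where
  "borel_probs = {P. prob_space P \<and> sets P = sets borel}"

text \<open>The coarsest topology on the Borel probability measures making \<open>P \<mapsto> \<integral> f dP\<close>
  continuous for every bounded continuous \<open>f\<close>.\<close>

definition weak_topology :: "'w::topological_space measure topology" where
  "weak_topology = topology_generated_by
     {{P \<in> borel_probs. (\<integral>\<omega>. f \<omega> \<partial>P) \<in> U} | (f :: 'w \<Rightarrow> real) U.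
        continuous_on UNIV f \<and> bounded (range f) \<and> open U}"

definition convex_measures :: "'w::topological_space measure set \<Rightarrow> bool" where
  "convex_measures \<P> \<longleftrightarrow>
     (\<forall>P\<in>\<P>. \<forall>Q\<in>\<P>. \<forall>u\<in>{0..1}. \<exists>R\<in>\<P>. \<forall>A\<in>sets borel.
        measure R A = (1 - u) * measure P A + u * measure Q A)"

definition representing_set ::
    "(('w::metric_space \<Rightarrow> real) \<Rightarrow> real) \<Rightarrow> 'w measure set \<Rightarrow> bool" where
  "representing_set E \<P> \<longleftrightarrow>
     \<P> \<subseteq> borel_probs \<and> convex_measures \<P> \<and> compactin weak_topology \<P> \<and>
     (\<forall>X\<in>bLip. E X = (SUP P\<in>\<P>. (\<integral>\<omega>. X \<omega> \<partial>P)))"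

definition upper_capacity :: "'w measure set \<Rightarrow> 'w set \<Rightarrow> real" where
  "upper_capacity \<P> A = (SUP P\<in>\<P>. measure P A)"

text \<open>The \<open>p\<close>-th power of the distance between \<open>X\<close> and \<open>Y\<close> in the norm \<open>E[\<bar>\<cdot>\<bar>^p]^(1/p)\<close>, with \<open>E\<close> written
  as the supremum over the representing set so that it is also meaningful outside \<open>bLip\<close>.\<close>

definition upper_moment ::
    "'w measure set \<Rightarrow> real \<Rightarrow> ('w \<Rightarrow> real) \<Rightarrow> ('w \<Rightarrow> real) \<Rightarrow> ennreal" where
  "upper_moment \<P> p X Y = (SUP P\<in>\<P>. \<integral>\<^sup>+\<omega>. ennreal (\<bar>X \<omega> - Y \<omega>\<bar> powr p) \<partial>P)"

text \<open>The completion of \<open>bLip\<close>, realised by Borel measurable representatives: those functions that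
  are limits of sequences in \<open>bLip\<close>. Functions that agree \<open>P\<close>-almost surely for every \<open>P \<in> \<P>\<close>
  represent the same element of the completion and are not identified here.\<close>

definition Lspace :: "'w::metric_space measure set \<Rightarrow> real \<Rightarrow> ('w \<Rightarrow> real) set" where
  "Lspace \<P> p = {X \<in> borel_measurable borel.
     \<exists>Y. (\<forall>k. Y k \<in> bLip) \<and> (\<lambda>k. upper_moment \<P> p X (Y k)) \<longlonglongrightarrow> 0}"

text \<open>The continuous extension of \<open>E\<close> from \<open>bLip\<close> to \<open>Lspace \<P> 1\<close>.\<close>

definition extend ::
    "'w::metric_space measure set \<Rightarrow> (('w \<Rightarrow> real) \<Rightarrow> real) \<Rightarrow> ('w \<Rightarrow> real) \<Rightarrow> real" where
  "extend \<P> E X = (THE l. \<forall>Y. (\<forall>k. Y k \<in> bLip) \<and> (\<lambda>k. upper_moment \<P> 1 X (Y k)) \<longlonglongrightarrow> 0 \<longrightarrow>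
     (\<lambda>k. E (Y k)) \<longlonglongrightarrow> l)"

text \<open>The limit in \<open>extend\<close> exists, and the representation of \<open>E\<close> extends with it.\<close>

lemma bLip_measurable: "X \<in> bLip \<Longrightarrow> X \<in> borel_measurable borel"
  unfolding bLip_def using borel_measurable_continuous_onI lipschitz_on_continuous_on by blast

lemma extend_eq_SUP:
  assumes E: "representing_set E \<P>" and ne: "\<P> \<noteq> {}" and X: "X \<in> Lspace \<P> 1"
  shows "extend \<P> E X = (SUP P\<in>\<P>. (\<integral>\<omega>. X \<omega> \<partial>P))"
proof -
  let ?S = "SUP P\<in>\<P>. (\<integral>\<omega>. X \<omega> \<partial>P)"
  have Xm: "X \<in> borel_measurable borel" using X by (simp add: Lspace_def)
  have prob: "prob_space P" "sets P = sets borel" if "P \<in> \<P>" for P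
    using E that by (auto simp: representing_set_def borel_probs_def)
  have key: "\<bar>E Y - ?S\<bar> \<le> e"
    if Y: "Y \<in> bLip" and e: "upper_moment \<P> 1 X Y < ennreal e" "e > 0" for Y e
  proof -
    obtain B where B: "\<And>\<omega>. \<bar>Y \<omega>\<bar> \<le> B"
      using Y by (auto simp: bLip_def bounded_iff)
    have *: "integrable P X \<and> integrable P Y \<and> \<bar>(\<integral>\<omega>. X \<omega> \<partial>P) - (\<integral>\<omega>. Y \<omega> \<partial>P)\<bar> \<le> e \<and> \<bar>\<integral>\<omega>. Y \<omega> \<partial>P\<bar> \<le> B" if P: "P \<in> \<P>" for P
    proof -
      interpret prob_space P using prob P by auto
      have [measurable]: "X \<in> borel_measurable P" "Y \<in> borel_measurable P"
        using Xm bLip_measurable[OF Y] prob(2)[OF P] measurable_cong_sets by blast+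
      have iY: "integrable P Y" by (rule integrable_const_bound[of _ B]) (auto simp: B)
      have le: "(\<integral>\<^sup>+\<omega>. ennreal \<bar>X \<omega> - Y \<omega>\<bar> \<partial>P) \<le> ennreal e"
      proof -
        have "(\<integral>\<^sup>+\<omega>. ennreal \<bar>X \<omega> - Y \<omega>\<bar> \<partial>P) = (\<integral>\<^sup>+\<omega>. ennreal (\<bar>X \<omega> - Y \<omega>\<bar> powr 1) \<partial>P)" by simp
        also have "\<dots> \<le> upper_moment \<P> 1 X Y" unfolding upper_moment_def by (rule SUP_upper[OF P])
        finally show ?thesis using e by simp
      qed
      have iD: "integrable P (\<lambda>\<omega>. X \<omega> - Y \<omega>)"
        by (rule integrableI_bounded) (use le in \<open>auto intro: le_less_trans\<close>)
      have iX: "integrable P X" using Bochner_Integration.integrable_add[OF iD iY] by simp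
      have "ennreal (\<integral>\<omega>. \<bar>X \<omega> - Y \<omega>\<bar> \<partial>P) \<le> ennreal e"
        using le iD by (subst nn_integral_eq_integral[symmetric]) auto
      hence "(\<integral>\<omega>. \<bar>X \<omega> - Y \<omega>\<bar> \<partial>P) \<le> e" using e by simp
      moreover have "\<bar>\<integral>\<omega>. X \<omega> - Y \<omega> \<partial>P\<bar> \<le> (\<integral>\<omega>. \<bar>X \<omega> - Y \<omega>\<bar> \<partial>P)" by (rule integral_abs_bound)
      moreover have "\<bar>\<integral>\<omega>. Y \<omega> \<partial>P\<bar> \<le> B"
      proof -
        have "(\<integral>\<omega>. \<bar>Y \<omega>\<bar> \<partial>P) \<le> (\<integral>\<omega>. B \<partial>P)" by (rule integral_mono) (use iY B in auto)
        then have "(\<integral>\<omega>. \<bar>Y \<omega>\<bar> \<partial>P) \<le> B" by (simp add: prob_space)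
        with integral_abs_bound[of P Y] show ?thesis by linarith
      qed
      ultimately show ?thesis using iX iY by (auto simp: prob_space)
    qed
    have EY: "E Y = (SUP P\<in>\<P>. (\<integral>\<omega>. Y \<omega> \<partial>P))" using E Y by (simp add: representing_set_def)
    have bY: "bdd_above ((\<lambda>P. \<integral>\<omega>. Y \<omega> \<partial>P) ` \<P>)" by (rule bdd_aboveI2[of _ _ B]) (use * in fastforce)
    have bX: "bdd_above ((\<lambda>P. \<integral>\<omega>. X \<omega> \<partial>P) ` \<P>)" by (rule bdd_aboveI2[of _ _ "B+e"]) (use * in fastforce)
    have "E Y \<le> ?S + e" unfolding EY
    proof (rule cSUP_least[OF ne])
      fix P assume P: "P \<in> \<P>"
      have "(\<integral>\<omega>. X \<omega> \<partial>P) \<le> ?S" by (rule cSUP_upper[OF P bX])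
      with *[OF P] show "(\<integral>\<omega>. Y \<omega> \<partial>P) \<le> ?S + e" by linarith
    qed
    moreover have "?S \<le> E Y + e"
    proof (rule cSUP_least[OF ne])
      fix P assume P: "P \<in> \<P>"
      have "(\<integral>\<omega>. Y \<omega> \<partial>P) \<le> E Y" unfolding EY by (rule cSUP_upper[OF P bY])
      with *[OF P] show "(\<integral>\<omega>. X \<omega> \<partial>P) \<le> E Y + e" by linarith
    qed
    ultimately show ?thesis by linarith
  qed
  have lim: "(\<lambda>k. E (Y k)) \<longlonglongrightarrow> ?S"
    if Y: "\<And>k. Y k \<in> bLip" "(\<lambda>k. upper_moment \<P> 1 X (Y k)) \<longlonglongrightarrow> 0" for Y
  proof (rule tendstoI)
    fix e :: real assume "e > 0"
    hence "\<forall>\<^sub>F k in sequentially. upper_moment \<P> 1 X (Y k) < ennreal (e/2)"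
      using order_tendstoD(2)[OF Y(2)] by simp
    thus "\<forall>\<^sub>F k in sequentially. dist (E (Y k)) ?S < e"
      by eventually_elim (use key[OF Y(1)] \<open>e > 0\<close> in \<open>force simp: dist_real_def\<close>)
  qed
  obtain Y0 where "\<And>k. Y0 k \<in> bLip" "(\<lambda>k. upper_moment \<P> 1 X (Y0 k)) \<longlonglongrightarrow> 0"
    using X by (auto simp: Lspace_def)
  then show ?thesis unfolding extend_def
    by (intro the_equality) (use lim LIMSEQ_unique in blast)+
qed

text \<open>Bounded Lipschitz functions of \<open>m\<close> vectors \<open>x 1, \<dots>, x m\<close>, for the Euclidean distance of the
  concatenated vectors. The Lipschitz bound forces independence of all other entries of \<open>x\<close>.\<close>

definition tuple_bLip :: "nat \<Rightarrow> ((nat \<Rightarrow> 'b::metric_space) \<Rightarrow> real) set" where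
  "tuple_bLip m = {\<psi>. bounded (range \<psi>) \<and>
     (\<exists>C. \<forall>x y. \<bar>\<psi> x - \<psi> y\<bar> \<le> C * L2_set (\<lambda>j. dist (x j) (y j)) {1..m})}"

definition indep_seq ::
    "'w::metric_space measure set \<Rightarrow> (('w \<Rightarrow> real) \<Rightarrow> real) \<Rightarrow> nat \<Rightarrow> (nat \<Rightarrow> 'w \<Rightarrow> 'b::metric_space) \<Rightarrow> bool"
  where
  "indep_seq \<P> E n X \<longleftrightarrow>
     (\<forall>i\<in>{1..<n}. \<forall>\<psi>\<in>tuple_bLip (i + 1).
        extend \<P> E (\<lambda>\<omega>. \<psi> (\<lambda>j. X j \<omega>)) =
        extend \<P> E (\<lambda>\<omega>. extend \<P> E (\<lambda>\<omega>'. \<psi> ((\<lambda>j. X j \<omega>)(i + 1 := X (i + 1) \<omega>')))))"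

definition mean_set ::
    "'w::metric_space measure set \<Rightarrow> (('w \<Rightarrow> real) \<Rightarrow> real) \<Rightarrow> ('w \<Rightarrow> 'b::real_inner) \<Rightarrow> 'b set" where
  "mean_set \<P> E X = {\<theta>. \<forall>p. \<theta> \<bullet> p \<le> extend \<P> E (\<lambda>\<omega>. p \<bullet> X \<omega>)}"

definition avg_mean_set ::
    "'w::metric_space measure set \<Rightarrow> (('w \<Rightarrow> real) \<Rightarrow> real) \<Rightarrow> nat \<Rightarrow> (nat \<Rightarrow> 'w \<Rightarrow> 'b::real_inner) \<Rightarrow> 'b set"
  where
  "avg_mean_set \<P> E n X =
     {(1 / real n) *\<^sub>R (\<Sum>i=1..n. \<theta> i) | \<theta>. \<forall>i\<in>{1..n}. \<theta> i \<in> mean_set \<P> E (X i)}"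

end

theory Submission
  imports Defs
begin

text \<open>
  Pinelis' method, run directly under the sublinear expectation. The function
  \<open>r \<mapsto> cosh (sqrt r)\<close> is convex, which gives
  \<open>E cosh (l |y + Z|) \<le> cosh (l b) cosh (l |y|)\<close> for a centred vector \<open>Z\<close> with \<open>|Z| \<le> b\<close>.
  Let \<open>T i\<close> be the Minkowski sum of the mean sets of \<open>X 1, \<dots>, X i\<close> and \<open>S i = X 1 + \<dots> + X i\<close>.
  Under every \<open>P \<in> \<P>\<close> the mean of \<open>X (i + 1)\<close> lies in its mean set, so comparing \<open>S i\<close> with an
  almost nearest point of \<open>T i\<close> and taking \<open>Z = X (i + 1) - E_P X (i + 1)\<close>, \<open>b = 2 M\<close>, bounds the
  upper expectation of \<open>cosh (l dist (s + X (i + 1), T (i + 1)))\<close> by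
  \<open>cosh (2 l M) cosh (l dist (s, T i))\<close>. Independence iterates this, and
  Markov's inequality with \<open>l = t / (4 M\<^sup>2)\<close> yields \<open>2 exp (- n t\<^sup>2 / (8 M\<^sup>2))\<close>, without any net of
  the sphere and hence without a dimensional factor.
\<close>

subsection \<open>Convexity of the hyperbolic cosine and a one-step bound\<close>

text \<open>The odd terms of the series vanish, so it can be reindexed along \<open>2 * k\<close>.
  As a power series in the square of \<open>x\<close> it allows the termwise comparisons of the next
  two lemmas.\<close>

lemma cosh_sums_even: "(\<lambda>k. x ^ (2 * k) / fact (2 * k)) sums cosh (x :: real)"
proof -
  have "(\<lambda>k. (\<lambda>n. if even n then x ^ n /\<^sub>R fact n else 0) (2 * k)) sums cosh x"
    by (rule iffD2[OF sums_mono_reindex cosh_converges])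
       (auto simp: strict_mono_def elim: evenE)
  then show ?thesis by (simp add: divide_inverse mult.commute)
qed

text \<open>This is monotonicity and convexity of \<open>cosh (sqrt r)\<close> in
  \<open>r \<ge> 0\<close>, stated without roots. The series in \<open>r\<close> has nonnegative
  coefficients, and every power of \<open>r\<close> is increasing and convex on the
  half-line.\<close>

lemma cosh_le_convex_comb:
  fixes a A B p q :: real
  assumes "a\<^sup>2 \<le> p * A\<^sup>2 + q * B\<^sup>2" "p \<ge> 0" "q \<ge> 0" "p + q = 1"
  shows "cosh a \<le> p * cosh A + q * cosh B"
proof (rule sums_le)
  show "(\<lambda>k. a ^ (2 * k) / fact (2 * k)) sums cosh a" by (rule cosh_sums_even)
  show "(\<lambda>k. p * (A ^ (2 * k) / fact (2 * k)) + q * (B ^ (2 * k) / fact (2 * k))) sums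
      (p * cosh A + q * cosh B)"
    by (intro sums_add sums_mult cosh_sums_even)
  fix k
  have conv: "convex_on {0..} (\<lambda>x::real. x ^ k)"
    by (rule convex_on_realI[where f' = "\<lambda>x. real k * x ^ (k - 1)"])
       (auto intro!: derivative_eq_intros mult_left_mono power_mono)
  have p: "p = 1 - q" using assms(4) by simp
  have "a ^ (2 * k) \<le> (p * A\<^sup>2 + q * B\<^sup>2) ^ k"
    unfolding power_mult using assms by (intro power_mono) auto
  also have "\<dots> \<le> p * (A\<^sup>2) ^ k + q * (B\<^sup>2) ^ k"
    using convex_onD[OF conv, of q "A\<^sup>2" "B\<^sup>2"] assms(2-3) unfolding p by simp
  finally have "a ^ (2 * k) \<le> p * A ^ (2 * k) + q * B ^ (2 * k)" by (simp only: power_mult)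
  then have "a ^ (2 * k) / fact (2 * k) \<le> (p * A ^ (2 * k) + q * B ^ (2 * k)) / fact (2 * k)"
    by (intro divide_right_mono) auto
  then show "a ^ (2 * k) / fact (2 * k) \<le>
      p * (A ^ (2 * k) / fact (2 * k)) + q * (B ^ (2 * k) / fact (2 * k))"
    by (simp add: add_divide_distrib)
qed

text \<open>Both sides are series in the square of \<open>x\<close>; comparing coefficients reduces
  the claim to \<open>2 ^ k * fact k \<le> fact (2 * k)\<close>.\<close>

lemma cosh_le_exp_half_square: "cosh x \<le> exp (x\<^sup>2 / 2)" for x :: real
proof (rule sums_le)
  show "(\<lambda>k. x ^ (2 * k) / fact (2 * k)) sums cosh x" by (rule cosh_sums_even)
  show "(\<lambda>k. (x\<^sup>2 / 2) ^ k /\<^sub>R fact k) sums exp (x\<^sup>2 / 2)" by (rule exp_converges)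
  fix k
  have "2 ^ k * fact k \<le> (fact (2 * k) :: real)"
  proof (induction k)
    case (Suc k)
    have "2 ^ Suc k * fact (Suc k) = (2 * real (Suc k)) * (2 ^ k * fact k)"
      by (simp add: algebra_simps)
    also have "\<dots> \<le> ((2 * real k + 2) * (2 * real k + 1)) * fact (2 * k)"
      by (intro mult_mono Suc) (auto simp: algebra_simps)
    also have "\<dots> = fact (2 * Suc k)" by (simp add: algebra_simps)
    finally show ?case .
  qed simp
  then have "x ^ (2 * k) / fact (2 * k) \<le> x ^ (2 * k) / (2 ^ k * fact k)"
    by (rule divide_left_mono) simp_all
  also have "\<dots> = (x\<^sup>2 / 2) ^ k /\<^sub>R fact k"
    unfolding power_mult power_divide by (simp add: divide_inverse)
  finally show "x ^ (2 * k) / fact (2 * k) \<le> (x\<^sup>2 / 2) ^ k /\<^sub>R fact k" .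
qed

text \<open>The constant \<open>c\<close> depends on \<open>y\<close> and \<open>b\<close> but not
  on \<open>z\<close>, so the last term disappears once a centred vector is substituted for
  \<open>z\<close> and integrated.\<close>

lemma cosh_norm_add_le:
  fixes y :: "'a::real_inner"
  assumes "b \<ge> 0"
  shows "\<exists>c. \<forall>z. norm z \<le> b \<longrightarrow> cosh (norm (y + z)) \<le> cosh b * cosh (norm y) + c * (y \<bullet> z)"
proof (cases "norm y * b = 0")
  \<comment> \<open>Here \<open>u\<close> below would divide by zero. One of \<open>norm y\<close>
    and \<open>b\<close> is 0, so the addition formula has no \<open>sinh\<close> term and the
    triangle inequality suffices.\<close>
  case True
  have "cosh (norm (y + z)) \<le> cosh b * cosh (norm y) + 0 * (y \<bullet> z)" if "norm z \<le> b" for z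
  proof -
    have "norm (y + z) \<le> norm y + b"
      using that norm_triangle_ineq[of y z] by linarith
    then have "cosh (norm (y + z)) \<le> cosh (norm y + b)"
      using assms by (subst cosh_real_nonneg_le_iff) auto
    also have "\<dots> = cosh b * cosh (norm y)"
      using True by (auto simp: cosh_add)
    finally show ?thesis by simp
  qed
  then show ?thesis by blast
next
  case False
  define r where "r = norm y"
  have rb: "r * b > 0" using False assms by (simp add: r_def zero_less_mult_iff less_le)
  have "cosh (norm (y + z)) \<le> cosh b * cosh r + sinh b * sinh r / (r * b) * (y \<bullet> z)"
    if z: "norm z \<le> b" for z
  proof -
    define u where "u = (y \<bullet> z) / (r * b)"
    have w: "y \<bullet> z = u * (r * b)" using rb by (auto simp: u_def)
    have "\<bar>y \<bullet> z\<bar> \<le> r * b"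
      using Cauchy_Schwarz_ineq2[of y z] z mult_left_mono[of "norm z" b r] by (simp add: r_def)
    then have u: "\<bar>u\<bar> \<le> 1" using rb by (simp add: u_def)
    have "(norm (y + z))\<^sup>2 = r\<^sup>2 + (norm z)\<^sup>2 + 2 * (y \<bullet> z)"
      by (simp add: r_def power2_norm_eq_inner inner_add inner_commute)
    also have "\<dots> \<le> r\<^sup>2 + b\<^sup>2 + 2 * (y \<bullet> z)" using z by (simp add: power_mono)
    \<comment> \<open>The bound is affine in \<open>u\<close>, with value
      \<open>(r + b)\<^sup>2\<close> at \<open>u = 1\<close> and \<open>(r - b)\<^sup>2\<close> at
      \<open>u = -1\<close>. As \<open>u\<close> lies between these, it is their convex
      combination.\<close>
    also have "\<dots> = (1 + u) / 2 * (r + b)\<^sup>2 + (1 - u) / 2 * (r - b)\<^sup>2"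
      unfolding w by (simp add: power2_eq_square field_simps)
    finally have "cosh (norm (y + z)) \<le> (1 + u) / 2 * cosh (r + b) + (1 - u) / 2 * cosh (r - b)"
      by (rule cosh_le_convex_comb) (use u in \<open>auto simp: field_simps\<close>)
    also have "\<dots> = cosh b * cosh r + sinh b * sinh r * u"
      by (simp add: cosh_add cosh_diff field_simps)
    finally show ?thesis by (simp add: u_def)
  qed
  then show ?thesis unfolding r_def by blast
qed

text \<open>The linear term of \<open>cosh_norm_add_le\<close>, applied to the vectors scaled by
  \<open>l\<close>, integrates to 0 because \<open>Z\<close> is centred.\<close>

lemma (in prob_space) expectation_cosh_norm_add_le:
  fixes Z :: "'a \<Rightarrow> 'b::euclidean_space"
  assumes [measurable]: "Z \<in> borel_measurable M" and b: "AE \<omega> in M. norm (Z \<omega>) \<le> b"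
    and mean: "expectation Z = 0" and l: "l \<ge> 0"
  shows "expectation (\<lambda>\<omega>. cosh (l * norm (y + Z \<omega>))) \<le> cosh (l * b) * cosh (l * norm y)"
proof -
  have b0: "b \<ge> 0"
  proof -
    have "AE \<omega> in M. 0 \<le> b" using b by eventually_elim (use norm_ge_zero order_trans in blast)
    then show ?thesis by simp
  qed
  have intZ: "integrable M Z" by (rule integrable_const_bound[OF b]) simp
  obtain c where c: "\<And>z. norm z \<le> l * b \<Longrightarrow>
      cosh (norm (l *\<^sub>R y + z)) \<le> cosh (l * b) * cosh (norm (l *\<^sub>R y)) + c * ((l *\<^sub>R y) \<bullet> z)"
    using cosh_norm_add_le[of "l * b" "l *\<^sub>R y"] b0 l by auto
  have le: "AE \<omega> in M. cosh (l * norm (y + Z \<omega>)) \<le>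
      cosh (l * b) * cosh (l * norm y) + c * l\<^sup>2 * (y \<bullet> Z \<omega>)"
    using b
  proof eventually_elim
    case (elim \<omega>)
    then have "norm (l *\<^sub>R Z \<omega>) \<le> l * b" using l by (simp add: mult_left_mono)
    from c[OF this] show ?case using l
      by (simp add: power2_eq_square mult.assoc flip: scaleR_add_right)
  qed
  have iR: "integrable M (\<lambda>\<omega>. cosh (l * b) * cosh (l * norm y) + c * l\<^sup>2 * (y \<bullet> Z \<omega>))"
    using intZ by simp
  have "expectation (\<lambda>\<omega>. cosh (l * norm (y + Z \<omega>))) \<le>
      expectation (\<lambda>\<omega>. cosh (l * b) * cosh (l * norm y) + c * l\<^sup>2 * (y \<bullet> Z \<omega>))"
    \<comment> \<open>This rule asks for a nonnegative majorant instead of integrability of the left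
      side; nonnegativity follows from \<open>le\<close>, since \<open>cosh\<close> is
      nonnegative.\<close>
    using le by (intro integral_mono_AE' iR) (auto elim!: eventually_mono intro: order_trans[rotated])
  also have "\<dots> = cosh (l * b) * cosh (l * norm y)"
    using intZ mean by (simp add: prob_space)
  finally show ?thesis .
qed

subsection \<open>Lipschitz images of elements of the completion\<close>

text \<open>The same approximating sequence works. Instead of the Cauchy-Schwarz inequality, the
  elementary bound \<open>\<bar>a\<bar> \<le> e + a\<^sup>2 / e\<close> is integrated and passed to
  the supremum, with \<open>e\<close> fixed before the limit is taken.\<close>

lemma Lspace_2_imp_1:
  assumes "\<P> \<subseteq> borel_probs" and X: "X \<in> Lspace \<P> 2"
  shows "X \<in> Lspace \<P> 1"
proof -
  obtain Y where Y: "\<And>k. Y k \<in> bLip" and lim: "(\<lambda>k. upper_moment \<P> 2 X (Y k)) \<longlonglongrightarrow> 0"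
    and Xm[measurable]: "X \<in> borel_measurable borel"
    using X by (auto simp: Lspace_def)
  have le: "upper_moment \<P> 1 X (Y k) \<le> ennreal e + ennreal (1 / e) * upper_moment \<P> 2 X (Y k)"
    if e: "e > 0" for e k
    unfolding upper_moment_def[of _ 1]
  proof (rule SUP_least)
    fix P assume P: "P \<in> \<P>"
    then interpret prob_space P using assms by (auto simp: borel_probs_def)
    have P': "sets P = sets borel" using P assms by (auto simp: borel_probs_def)
    have [measurable]: "X \<in> borel_measurable P" "Y k \<in> borel_measurable P"
      using Xm bLip_measurable[OF Y] measurable_cong_sets[OF P' refl] by blast+
    have "\<bar>a\<bar> powr 1 \<le> e + 1 / e * \<bar>a\<bar> powr 2" for a :: real
    proof -
      have "0 \<le> (\<bar>a\<bar> - e)\<^sup>2 + e * \<bar>a\<bar>" using e by simp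
      then have "e * \<bar>a\<bar> \<le> e * e + a\<^sup>2" by (simp add: power2_eq_square algebra_simps)
      then show ?thesis using e by (simp add: field_simps powr_numeral)
    qed
    then have "(\<integral>\<^sup>+\<omega>. ennreal (\<bar>X \<omega> - Y k \<omega>\<bar> powr 1) \<partial>P) \<le>
        (\<integral>\<^sup>+\<omega>. ennreal e + ennreal (1 / e) * ennreal (\<bar>X \<omega> - Y k \<omega>\<bar> powr 2) \<partial>P)"
      using e by (intro nn_integral_mono) (simp flip: ennreal_mult ennreal_plus)
    also have "\<dots> = ennreal e + ennreal (1 / e) * (\<integral>\<^sup>+\<omega>. ennreal (\<bar>X \<omega> - Y k \<omega>\<bar> powr 2) \<partial>P)"
      by (simp add: nn_integral_add nn_integral_cmult emeasure_space_1)
    also have "\<dots> \<le> ennreal e + ennreal (1 / e) * upper_moment \<P> 2 X (Y k)"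
      unfolding upper_moment_def by (intro add_left_mono mult_left_mono SUP_upper P) simp
    finally show "(\<integral>\<^sup>+\<omega>. ennreal (\<bar>X \<omega> - Y k \<omega>\<bar> powr 1) \<partial>P) \<le>
        ennreal e + ennreal (1 / e) * upper_moment \<P> 2 X (Y k)" .
  qed
  have "(\<lambda>k. upper_moment \<P> 1 X (Y k)) \<longlonglongrightarrow> 0"
  proof (rule order_tendstoI)
    fix a :: ennreal assume "0 < a"
    then obtain b where b: "0 < b" "b < a" using dense by blast
    then obtain r where r: "0 < r" "ennreal r < a"
      by (cases b) (auto simp: ennreal_less_zero_iff)
    define e where "e = r / 2"
    have e: "e > 0" "ennreal e < a" using r by (auto simp: e_def intro: le_less_trans[OF ennreal_leI, rotated])
    have "(\<lambda>k. ennreal e + ennreal (1 / e) * upper_moment \<P> 2 X (Y k)) \<longlonglongrightarrow> ennreal e + ennreal (1 / e) * 0"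
      by (intro tendsto_intros lim ennreal_tendsto_cmult) simp
    then have "\<forall>\<^sub>F k in sequentially. ennreal e + ennreal (1 / e) * upper_moment \<P> 2 X (Y k) < a"
      using e by (intro order_tendstoD) auto
    then show "\<forall>\<^sub>F k in sequentially. upper_moment \<P> 1 X (Y k) < a"
      by eventually_elim (use le[OF e(1)] le_less_trans in blast)
  qed auto
  then show ?thesis using Y by (auto simp: Lspace_def)
qed

lemma bLip_add: "X \<in> bLip \<Longrightarrow> Y \<in> bLip \<Longrightarrow> (\<lambda>\<omega>. X \<omega> + Y \<omega>) \<in> bLip"
  unfolding bLip_def using bounded_plus_comp[of X UNIV Y] lipschitz_on_add by (auto; blast)

lemma Lspace_1_add:
  assumes sub: "\<P> \<subseteq> borel_probs" and X: "X \<in> Lspace \<P> 1" and Y: "Y \<in> Lspace \<P> 1"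
  shows "(\<lambda>\<omega>. X \<omega> + Y \<omega>) \<in> Lspace \<P> 1"
proof -
  obtain X' where X': "\<And>k. X' k \<in> bLip" "(\<lambda>k. upper_moment \<P> 1 X (X' k)) \<longlonglongrightarrow> 0"
    and Xm[measurable]: "X \<in> borel_measurable borel"
    using X by (auto simp: Lspace_def)
  obtain Y' where Y': "\<And>k. Y' k \<in> bLip" "(\<lambda>k. upper_moment \<P> 1 Y (Y' k)) \<longlonglongrightarrow> 0"
    and Ym[measurable]: "Y \<in> borel_measurable borel"
    using Y by (auto simp: Lspace_def)
  have le: "upper_moment \<P> 1 (\<lambda>\<omega>. X \<omega> + Y \<omega>) (\<lambda>\<omega>. X' k \<omega> + Y' k \<omega>) \<le>
      upper_moment \<P> 1 X (X' k) + upper_moment \<P> 1 Y (Y' k)" for k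
    unfolding upper_moment_def[of _ _ "\<lambda>\<omega>. X \<omega> + Y \<omega>"]
  proof (rule SUP_least)
    fix P assume P: "P \<in> \<P>"
    have P': "sets P = sets borel" using P sub by (auto simp: borel_probs_def)
    have [measurable]: "X \<in> borel_measurable P" "X' k \<in> borel_measurable P"
        "Y \<in> borel_measurable P" "Y' k \<in> borel_measurable P"
      using Xm Ym bLip_measurable[OF X'(1)] bLip_measurable[OF Y'(1)]
        measurable_cong_sets[OF P' refl] by blast+
    have "(\<integral>\<^sup>+\<omega>. ennreal (\<bar>X \<omega> + Y \<omega> - (X' k \<omega> + Y' k \<omega>)\<bar> powr 1) \<partial>P) \<le>
        (\<integral>\<^sup>+\<omega>. ennreal (\<bar>X \<omega> - X' k \<omega>\<bar> powr 1) + ennreal (\<bar>Y \<omega> - Y' k \<omega>\<bar> powr 1) \<partial>P)"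
      by (intro nn_integral_mono) (simp flip: ennreal_plus)
    also have "\<dots> = (\<integral>\<^sup>+\<omega>. ennreal (\<bar>X \<omega> - X' k \<omega>\<bar> powr 1) \<partial>P) +
        (\<integral>\<^sup>+\<omega>. ennreal (\<bar>Y \<omega> - Y' k \<omega>\<bar> powr 1) \<partial>P)"
      by (intro nn_integral_add) simp_all
    also have "\<dots> \<le> upper_moment \<P> 1 X (X' k) + upper_moment \<P> 1 Y (Y' k)"
      unfolding upper_moment_def by (intro add_mono SUP_upper P)
    finally show "(\<integral>\<^sup>+\<omega>. ennreal (\<bar>X \<omega> + Y \<omega> - (X' k \<omega> + Y' k \<omega>)\<bar> powr 1) \<partial>P) \<le> \<dots>" .
  qed
  have "(\<lambda>k. upper_moment \<P> 1 X (X' k) + upper_moment \<P> 1 Y (Y' k)) \<longlonglongrightarrow> 0"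
    using tendsto_add[OF X'(2) Y'(2)] by simp
  then have "(\<lambda>k. upper_moment \<P> 1 (\<lambda>\<omega>. X \<omega> + Y \<omega>) (\<lambda>\<omega>. X' k \<omega> + Y' k \<omega>)) \<longlonglongrightarrow> 0"
    by (rule tendsto_sandwich[OF _ _ tendsto_const, rotated 2]) (use le in auto)
  then show ?thesis using bLip_add[OF X'(1) Y'(1)]
    by (auto simp: Lspace_def intro!: exI[of _ "\<lambda>k \<omega>. X' k \<omega> + Y' k \<omega>"])
qed

definition vec_Lspace :: "'w::metric_space measure set \<Rightarrow> real \<Rightarrow> ('w \<Rightarrow> real ^ 'd) set" where
  "vec_Lspace \<P> p = {X. \<forall>k. (\<lambda>\<omega>. X \<omega> $ k) \<in> Lspace \<P> p}"

lemma vec_Lspace_measurable: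
  assumes "X \<in> vec_Lspace \<P> p"
  shows "X \<in> borel_measurable borel"
  using assms
  by (subst borel_measurable_euclidean_space)
     (auto simp: Basis_vec_def inner_axis vec_Lspace_def Lspace_def)

lemma vec_Lspace_1_add:
  "\<P> \<subseteq> borel_probs \<Longrightarrow> X \<in> vec_Lspace \<P> 1 \<Longrightarrow> Y \<in> vec_Lspace \<P> 1 \<Longrightarrow>
    (\<lambda>\<omega>. X \<omega> + Y \<omega>) \<in> vec_Lspace \<P> 1"
  by (simp add: vec_Lspace_def Lspace_1_add)

lemma lipschitz_on_vec:
  fixes Y :: "'d::finite \<Rightarrow> 'w::metric_space \<Rightarrow> real"
  assumes "\<And>j. (C j)-lipschitz_on UNIV (Y j)"
  shows "(\<Sum>j\<in>UNIV. C j)-lipschitz_on UNIV (\<lambda>\<omega>. \<chi> j. Y j \<omega>)"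
proof (rule lipschitz_onI)
  fix x y
  have "dist (\<chi> j. Y j x) (\<chi> j. Y j y) \<le> (\<Sum>j\<in>UNIV. dist (Y j x) (Y j y))"
    unfolding dist_norm by (rule order_trans[OF norm_le_l1_cart]) (simp add: dist_real_def)
  also have "\<dots> \<le> (\<Sum>j\<in>UNIV. C j * dist x y)"
    by (intro sum_mono lipschitz_onD[OF assms]) auto
  finally show "dist (\<chi> j. Y j x) (\<chi> j. Y j y) \<le> (\<Sum>j\<in>UNIV. C j) * dist x y"
    by (simp add: sum_distrib_right)
qed (use assms lipschitz_on_nonneg in \<open>blast intro: sum_nonneg\<close>)

lemma lipschitz_bounded_image:
  assumes "L-lipschitz_on UNIV f" "bounded S"
  shows "bounded (f ` S)"
proof -
  obtain a e where "\<And>x. x \<in> S \<Longrightarrow> dist a x \<le> e" using assms(2) by (auto simp: bounded_def)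
  then have "dist (f a) (f x) \<le> L * e" if "x \<in> S" for x
    using that lipschitz_onD[OF assms(1), of a x] lipschitz_on_nonneg[OF assms(1)]
    by (meson UNIV_I mult_left_mono order_trans)
  then show ?thesis by (auto simp: bounded_def)
qed

text \<open>Approximate \<open>X\<close> componentwise by bounded Lipschitz vectors
  \<open>V k\<close>. Even if \<open>f\<close> is unbounded, \<open>f\<close> of \<open>V k\<close>
  is bounded, since \<open>V k\<close> has bounded range; the error is at most \<open>L\<close>
  times the sum of the component errors. Linear functionals, truncated \<open>cosh\<close> functions
  and inner expectations are all treated this way.\<close>

lemma lipschitz_comp_Lspace_1:
  fixes X :: "'w::metric_space \<Rightarrow> real ^ 'd"
  assumes sub: "\<P> \<subseteq> borel_probs" and X: "X \<in> vec_Lspace \<P> 1" and f: "L-lipschitz_on UNIV f"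
  shows "(\<lambda>\<omega>. f (X \<omega>)) \<in> Lspace \<P> 1"
proof -
  have "\<forall>j. \<exists>Y. (\<forall>k. Y k \<in> bLip) \<and> (\<lambda>k. upper_moment \<P> 1 (\<lambda>\<omega>. X \<omega> $ j) (Y k)) \<longlonglongrightarrow> 0"
    using X by (auto simp: vec_Lspace_def Lspace_def)
  then obtain Y where Y: "\<And>j k. Y j k \<in> bLip"
    "\<And>j. (\<lambda>k. upper_moment \<P> 1 (\<lambda>\<omega>. X \<omega> $ j) (Y j k)) \<longlonglongrightarrow> 0" by metis
  note Xm = vec_Lspace_measurable[OF X]
  have L: "L \<ge> 0" using f lipschitz_on_nonneg by blast
  define V where "V k \<omega> = (\<chi> j. Y j k \<omega>)" for k \<omega>
  have fm: "f \<in> borel_measurable borel"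
    using f by (intro borel_measurable_continuous_onI lipschitz_on_continuous_on)
  have bLip: "(\<lambda>\<omega>. f (V k \<omega>)) \<in> bLip" for k
  proof -
    obtain C where C: "\<And>j. (C j)-lipschitz_on UNIV (Y j k)"
      using Y(1)[of _ k] unfolding bLip_def mem_Collect_eq by metis
    have "\<exists>B. \<forall>\<omega>. \<bar>Y j k \<omega>\<bar> \<le> B" for j
      using Y(1)[of j k] by (auto simp: bLip_def bounded_iff)
    then obtain B where B: "\<And>j \<omega>. \<bar>Y j k \<omega>\<bar> \<le> B j" by metis
    have "norm (V k \<omega>) \<le> (\<Sum>j\<in>UNIV. B j)" for \<omega>
      by (intro order_trans[OF norm_le_l1_cart] sum_mono) (simp add: V_def B)
    then have "bounded (range (V k))" by (auto simp: bounded_iff)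
    then have "bounded (range (\<lambda>\<omega>. f (V k \<omega>)))"
      using lipschitz_bounded_image[OF f, of "range (V k)"] by (simp add: image_image)
    moreover have "(L * (\<Sum>j\<in>UNIV. C j))-lipschitz_on UNIV (\<lambda>\<omega>. f (V k \<omega>))"
      using lipschitz_on_compose2[OF lipschitz_on_vec[of C "\<lambda>j. Y j k", OF C], of L f] f
      by (simp add: V_def lipschitz_on_subset)
    ultimately show ?thesis by (auto simp: bLip_def)
  qed
  have le: "upper_moment \<P> 1 (\<lambda>\<omega>. f (X \<omega>)) (\<lambda>\<omega>. f (V k \<omega>)) \<le>
      ennreal L * (\<Sum>j\<in>UNIV. upper_moment \<P> 1 (\<lambda>\<omega>. X \<omega> $ j) (Y j k))" for k
    unfolding upper_moment_def[of _ _ "\<lambda>\<omega>. f (X \<omega>)"]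
  proof (rule SUP_least)
    fix P assume P: "P \<in> \<P>"
    have P': "sets P = sets borel" using P sub by (auto simp: borel_probs_def)
    have "(\<lambda>\<omega>. X \<omega> $ j) \<in> borel_measurable borel" for j
      using X by (simp add: vec_Lspace_def Lspace_def)
    then have [measurable]: "(\<lambda>\<omega>. X \<omega> $ j) \<in> borel_measurable P" "Y j k \<in> borel_measurable P" for j
      using bLip_measurable[OF Y(1)] measurable_cong_sets[OF P' refl] by blast+
    have "\<bar>f (X \<omega>) - f (V k \<omega>)\<bar> powr 1 \<le> L * (\<Sum>j\<in>UNIV. \<bar>X \<omega> $ j - Y j k \<omega>\<bar>)" for \<omega>
    proof -
      have "\<bar>f (X \<omega>) - f (V k \<omega>)\<bar> \<le> L * norm (X \<omega> - V k \<omega>)"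
        using lipschitz_onD[OF f, of "X \<omega>" "V k \<omega>"] by (simp add: dist_norm)
      also have "\<dots> \<le> L * (\<Sum>j\<in>UNIV. \<bar>X \<omega> $ j - Y j k \<omega>\<bar>)"
        using norm_le_l1_cart[of "X \<omega> - V k \<omega>"] L by (intro mult_left_mono) (auto simp: V_def)
      finally show ?thesis by simp
    qed
    then have "(\<integral>\<^sup>+\<omega>. ennreal (\<bar>f (X \<omega>) - f (V k \<omega>)\<bar> powr 1) \<partial>P) \<le>
        (\<integral>\<^sup>+\<omega>. ennreal L * (\<Sum>j\<in>UNIV. ennreal (\<bar>X \<omega> $ j - Y j k \<omega>\<bar> powr 1)) \<partial>P)"
      using L by (intro nn_integral_mono) (simp flip: ennreal_mult add: sum_nonneg)
    also have "\<dots> = ennreal L * (\<Sum>j\<in>UNIV. \<integral>\<^sup>+\<omega>. ennreal (\<bar>X \<omega> $ j - Y j k \<omega>\<bar> powr 1) \<partial>P)"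
      by (subst nn_integral_cmult) (simp_all add: nn_integral_sum del: sum_ennreal)
    also have "\<dots> \<le> ennreal L * (\<Sum>j\<in>UNIV. upper_moment \<P> 1 (\<lambda>\<omega>. X \<omega> $ j) (Y j k))"
      unfolding upper_moment_def by (intro mult_left_mono sum_mono SUP_upper P) simp
    finally show "(\<integral>\<^sup>+\<omega>. ennreal (\<bar>f (X \<omega>) - f (V k \<omega>)\<bar> powr 1) \<partial>P) \<le> \<dots>" .
  qed
  have "(\<lambda>k. ennreal L * (\<Sum>j\<in>UNIV. upper_moment \<P> 1 (\<lambda>\<omega>. X \<omega> $ j) (Y j k))) \<longlonglongrightarrow> ennreal L * (\<Sum>j\<in>(UNIV::'d set). 0)"
    by (intro ennreal_tendsto_cmult tendsto_sum Y) simp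
  then have "(\<lambda>k. ennreal L * (\<Sum>j\<in>UNIV. upper_moment \<P> 1 (\<lambda>\<omega>. X \<omega> $ j) (Y j k))) \<longlonglongrightarrow> 0" by simp
  then have "(\<lambda>k. upper_moment \<P> 1 (\<lambda>\<omega>. f (X \<omega>)) (\<lambda>\<omega>. f (V k \<omega>))) \<longlonglongrightarrow> 0"
    by (rule tendsto_sandwich[OF _ _ tendsto_const, rotated 2]) (use le in auto)
  moreover have "(\<lambda>\<omega>. f (X \<omega>)) \<in> borel_measurable borel" using fm Xm by measurable
  ultimately show ?thesis using bLip by (auto simp: Lspace_def intro!: exI[of _ "\<lambda>k \<omega>. f (V k \<omega>)"])
qed

subsection \<open>The sublinear one-step bound\<close>

text \<open>The distance is truncated at \<open>K\<close> because independence only speaks about bounded Lipschitz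
  functions. The one-step bound survives the truncation, and Markov's inequality needs
  no more than \<open>K = n t\<close>.\<close>

definition dist_cosh :: "real \<Rightarrow> real \<Rightarrow> 'a::metric_space set \<Rightarrow> 'a \<Rightarrow> real" where
  "dist_cosh l K A v = cosh (l * min (infdist v A) K)"

lemma dist_cosh_nonneg: "dist_cosh l K A v \<ge> 0"
  by (simp add: dist_cosh_def)

lemma dist_cosh_le: "l \<ge> 0 \<Longrightarrow> K \<ge> 0 \<Longrightarrow> dist_cosh l K A v \<le> cosh (l * K)"
  unfolding dist_cosh_def
  by (subst cosh_real_nonneg_le_iff) (auto intro: mult_left_mono simp: infdist_nonneg)

text \<open>The truncation confines the argument of \<open>cosh\<close> to
  \<open>{0..l * K}\<close>, where the derivative \<open>sinh\<close> is at most
  \<open>sinh (l * K)\<close>; the distance to a set is itself 1-Lipschitz.\<close>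

lemma dist_cosh_lipschitz:
  assumes l: "l \<ge> 0" and K: "K \<ge> 0"
  shows "(sinh (l * K) * l)-lipschitz_on UNIV (dist_cosh l K A)"
proof (rule lipschitz_onI)
  fix x y
  have mem: "l * min (infdist v A) K \<in> {0..l * K}" for v
    using l K by (auto simp: infdist_nonneg intro: mult_left_mono)
  have "norm (dist_cosh l K A x - dist_cosh l K A y) \<le>
      sinh (l * K) * norm (l * min (infdist x A) K - l * min (infdist y A) K)"
    unfolding dist_cosh_def
  proof (rule field_differentiable_bound[where f' = sinh, OF _ _ _ mem mem])
    show "(cosh has_field_derivative sinh z) (at z within {0..l * K})" for z
      by (auto intro!: derivative_eq_intros)
  qed (use mem in \<open>auto simp: sinh_real_nonneg_iff\<close>)
  also have "norm (l * min (infdist x A) K - l * min (infdist y A) K) \<le> l * dist x y"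
  proof -
    have "\<bar>min (infdist x A) K - min (infdist y A) K\<bar> \<le> dist x y"
      using infdist_triangle_abs[of x A y] by linarith
    then show ?thesis using l by (simp add: abs_mult mult_left_mono flip: right_diff_distrib)
  qed
  finally show "dist (dist_cosh l K A x) (dist_cosh l K A y) \<le> sinh (l * K) * l * dist x y"
    using l K by (simp add: dist_norm mult_left_mono mult.assoc)
qed (use l K in auto)

section \<open>The extended expectation as a supremum of integrals\<close>

locale sublinear_representation =
  fixes E :: "('w::metric_space \<Rightarrow> real) \<Rightarrow> real" and \<P> :: "'w measure set"
  assumes rep: "representing_set E \<P>" and ne: "\<P> \<noteq> {}"
begin

lemma subset: "\<P> \<subseteq> borel_probs"
  using rep by (simp add: representing_set_def)

lemma prob: "P \<in> \<P> \<Longrightarrow> prob_space P" and sets: "P \<in> \<P> \<Longrightarrow> sets P = sets borel"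
  using subset by (auto simp: borel_probs_def)

lemma measurable: "P \<in> \<P> \<Longrightarrow> X \<in> borel_measurable borel \<Longrightarrow> X \<in> borel_measurable P"
  using measurable_cong_sets[OF sets refl] by blast

lemma extend_le:
  assumes "Z \<in> Lspace \<P> 1" "\<And>P. P \<in> \<P> \<Longrightarrow> integral\<^sup>L P Z \<le> c"
  shows "extend \<P> E Z \<le> c"
  using assms by (auto simp: extend_eq_SUP[OF rep ne] intro!: cSUP_least ne)

text \<open>The bound \<open>B\<close> is uniform over the representing set, so the family of
  integrals is bounded above and its real supremum dominates each member.\<close>

lemma le_extend:
  assumes Z: "Z \<in> Lspace \<P> 1" and B: "\<And>Q. Q \<in> \<P> \<Longrightarrow> AE \<omega> in Q. \<bar>Z \<omega>\<bar> \<le> B" and P: "P \<in> \<P>"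
  shows "integral\<^sup>L P Z \<le> extend \<P> E Z"
  unfolding extend_eq_SUP[OF rep ne Z]
proof (rule cSUP_upper[OF P], rule bdd_aboveI2)
  fix Q assume Q: "Q \<in> \<P>"
  interpret prob_space Q by (rule prob[OF Q])
  have "integrable Q Z"
    using B[OF Q] Z by (intro integrable_const_bound[of _ B] measurable[OF Q]) (auto simp: Lspace_def)
  then show "integral\<^sup>L Q Z \<le> B"
    by (rule integral_le_const) (use B[OF Q] in eventually_elim, linarith)
qed

text \<open>Integrating the functional \<open>p \<bullet> X\<close> under one \<open>P\<close> gives
  at most the supremum over the representing set, for every direction \<open>p\<close>.\<close>

lemma mean_in_mean_set:
  fixes X :: "'w \<Rightarrow> real ^ 'd"
  assumes X: "X \<in> vec_Lspace \<P> 1" and M: "\<And>Q. Q \<in> \<P> \<Longrightarrow> AE \<omega> in Q. norm (X \<omega>) \<le> M" and P: "P \<in> \<P>"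
  shows "integral\<^sup>L P X \<in> mean_set \<P> E X"
  unfolding mean_set_def
proof safe
  fix p
  interpret prob_space P by (rule prob[OF P])
  have "integrable P X"
    using M[OF P] by (rule integrable_const_bound) (rule measurable[OF P vec_Lspace_measurable[OF X]])
  then have "integral\<^sup>L P X \<bullet> p = (\<integral>\<omega>. p \<bullet> X \<omega> \<partial>P)" by (simp add: inner_commute)
  also have "\<dots> \<le> extend \<P> E (\<lambda>\<omega>. p \<bullet> X \<omega>)"
  proof (rule le_extend[OF _ _ P])
    have "(norm p)-lipschitz_on UNIV (\<lambda>v. p \<bullet> v)"
      by (rule lipschitz_onI)
         (auto simp: dist_norm Cauchy_Schwarz_ineq2 simp flip: inner_diff_right)
    then show "(\<lambda>\<omega>. p \<bullet> X \<omega>) \<in> Lspace \<P> 1" by (rule lipschitz_comp_Lspace_1[OF subset X])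
    show "AE \<omega> in Q. \<bar>p \<bullet> X \<omega>\<bar> \<le> norm p * M" if "Q \<in> \<P>" for Q
      using M[OF that]
    proof eventually_elim
      case (elim \<omega>)
      then show ?case
        using Cauchy_Schwarz_ineq2[of p "X \<omega>"] mult_left_mono[OF elim norm_ge_zero[of p]] by linarith
    qed
  qed
  finally show "integral\<^sup>L P X \<bullet> p \<le> extend \<P> E (\<lambda>\<omega>. p \<bullet> X \<omega>)" .
qed

lemma dist_cosh_shift_Lspace:
  fixes X :: "'w \<Rightarrow> real ^ 'd"
  assumes X: "X \<in> vec_Lspace \<P> 1" and l: "l \<ge> 0" and K: "K \<ge> 0"
  shows "(\<lambda>\<omega>. dist_cosh l K B (s + X \<omega>)) \<in> Lspace \<P> 1"
proof (rule lipschitz_comp_Lspace_1[OF subset X])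
  show "(sinh (l * K) * l)-lipschitz_on UNIV (\<lambda>v. dist_cosh l K B (s + v))"
    using dist_cosh_lipschitz[OF l K, of B]
    by (auto intro!: lipschitz_onI dest: lipschitz_onD[of _ _ _ "s + _" "s + _"] lipschitz_on_nonneg)
qed

text \<open>The right side is free of \<open>P\<close>, so it suffices to bound the integral under
  each \<open>P\<close> separately, recentring \<open>X\<close> at its own mean under
  \<open>P\<close>. By \<open>AB\<close> the set \<open>B\<close> absorbs that mean, whatever
  \<open>P\<close> is.\<close>

lemma extend_dist_cosh_le:
  fixes X :: "'w \<Rightarrow> real ^ 'd"
  assumes X: "X \<in> vec_Lspace \<P> 1" and M: "\<And>Q. Q \<in> \<P> \<Longrightarrow> AE \<omega> in Q. norm (X \<omega>) \<le> M"
    and A: "A \<noteq> {}" and AB: "\<And>a \<theta>. a \<in> A \<Longrightarrow> \<theta> \<in> mean_set \<P> E X \<Longrightarrow> a + \<theta> \<in> B"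
    and l: "l \<ge> 0" and K: "K \<ge> 0"
  shows "extend \<P> E (\<lambda>\<omega>. dist_cosh l K B (s + X \<omega>)) \<le> cosh (l * (2 * M)) * dist_cosh l K A s"
proof (rule extend_le[OF dist_cosh_shift_Lspace[OF X l K]])
  fix P assume P: "P \<in> \<P>"
  interpret prob_space P by (rule prob[OF P])
  have Xm[measurable]: "X \<in> borel_measurable P"
    by (rule measurable[OF P vec_Lspace_measurable[OF X]])
  have iX: "integrable P X" using M[OF P] by (rule integrable_const_bound) measurable
  define m where "m = expectation X"
  have m: "m \<in> mean_set \<P> E X" unfolding m_def by (rule mean_in_mean_set[OF X M P])
  have hm: "(\<lambda>\<omega>. dist_cosh l K B (s + X \<omega>)) \<in> borel_measurable P"
    using dist_cosh_shift_Lspace[OF X l K, of B s] by (intro measurable[OF P]) (auto simp: Lspace_def)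
  have ih: "integrable P (\<lambda>\<omega>. dist_cosh l K B (s + X \<omega>))"
    by (intro integrable_const_bound[OF _ hm, of "cosh (l * K)"] AE_I2)
       (simp add: dist_cosh_nonneg dist_cosh_le[OF l K])
  show "expectation (\<lambda>\<omega>. dist_cosh l K B (s + X \<omega>)) \<le> cosh (l * (2 * M)) * dist_cosh l K A s"
  proof (cases "infdist s A < K")
    case False
    \<comment> \<open>The truncation is already active at \<open>s\<close>, so the right side
      contains the maximal value \<open>cosh (l * K)\<close> times a factor that is at least
      1.\<close>
    have "expectation (\<lambda>\<omega>. dist_cosh l K B (s + X \<omega>)) \<le> cosh (l * K)"
      using dist_cosh_le[OF l K] by (intro integral_le_const ih) auto
    also have "\<dots> \<le> cosh (l * (2 * M)) * cosh (l * K)"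
      using mult_right_mono[OF cosh_real_ge_1[of "l * (2 * M)"], of "cosh (l * K)"] by simp
    finally show ?thesis using False by (simp add: dist_cosh_def)
  next
    case True
    have M2: "AE \<omega> in P. norm (X \<omega> - m) \<le> 2 * M"
    proof -
      have "norm m \<le> expectation (\<lambda>\<omega>. norm (X \<omega>))" unfolding m_def by (rule integral_norm_bound)
      also have "\<dots> \<le> M" using M[OF P] iX by (intro integral_le_const) auto
      finally have "norm m \<le> M" .
      from M[OF P] show ?thesis
      proof eventually_elim
        case (elim \<omega>)
        then show ?case using \<open>norm m \<le> M\<close> norm_triangle_ineq4[of "X \<omega>" m] by linarith
      qed
    qed
    \<comment> \<open>The distance to \<open>A\<close> need not be attained. Any radius above it
      yields a point \<open>a\<close> of \<open>A\<close>, and the radius tends to the distance at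
      the end.\<close>
    have bound: "expectation (\<lambda>\<omega>. dist_cosh l K B (s + X \<omega>)) \<le> cosh (l * (2 * M)) * cosh (l * r)"
      if r: "r > infdist s A" for r
    proof -
      obtain a where a: "a \<in> A" "dist s a < r"
        using r A by (auto simp: infdist_notempty cINF_less_iff)
      have "expectation (\<lambda>\<omega>. dist_cosh l K B (s + X \<omega>)) \<le>
          expectation (\<lambda>\<omega>. cosh (l * norm ((s - a) + (X \<omega> - m))))"
      proof (rule integral_mono[OF ih])
        have "AE \<omega> in P. norm (cosh (l * norm ((s - a) + (X \<omega> - m)))) \<le>
            cosh (l * (norm (s - a) + 2 * M))"
          using M2
        proof eventually_elim
          case (elim \<omega>)
          have "norm ((s - a) + (X \<omega> - m)) \<le> norm (s - a) + 2 * M"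
            using elim norm_triangle_ineq[of "s - a" "X \<omega> - m"] by linarith
          moreover have "0 \<le> norm (s - a) + 2 * M"
            using calculation norm_ge_zero order_trans by blast
          ultimately show ?case
            using l by (simp add: cosh_real_nonneg_le_iff mult_left_mono)
        qed
        then show "integrable P (\<lambda>\<omega>. cosh (l * norm ((s - a) + (X \<omega> - m))))"
          by (rule integrable_const_bound) (intro borel_measurable_continuous_on[of cosh] continuous_intros; measurable)
        show "dist_cosh l K B (s + X \<omega>) \<le> cosh (l * norm ((s - a) + (X \<omega> - m)))" for \<omega>
        proof -
          \<comment> \<open>The point \<open>a + m\<close> of \<open>B\<close> serves as competitor
            for the infimum.\<close>
          have "infdist (s + X \<omega>) B \<le> norm ((s - a) + (X \<omega> - m))"
            using infdist_le[OF AB[OF a(1) m], of "s + X \<omega>"] by (simp add: dist_norm algebra_simps)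
          then show ?thesis unfolding dist_cosh_def using l K
            by (subst cosh_real_nonneg_le_iff) (auto simp: infdist_nonneg intro!: mult_left_mono)
        qed
      qed
      also have "\<dots> \<le> cosh (l * (2 * M)) * cosh (l * norm (s - a))"
        using iX M2 l by (intro expectation_cosh_norm_add_le) (auto simp: m_def prob_space)
      also have "\<dots> \<le> cosh (l * (2 * M)) * cosh (l * r)"
      proof -
        have "l * norm (s - a) \<le> l * r" using a l by (intro mult_left_mono) (auto simp: dist_norm)
        moreover have "0 \<le> l * norm (s - a)" using l by simp
        ultimately show ?thesis by (intro mult_left_mono) (auto simp: cosh_real_nonneg_le_iff)
      qed
      finally show ?thesis .
    qed
    have "expectation (\<lambda>\<omega>. dist_cosh l K B (s + X \<omega>)) \<le> cosh (l * (2 * M)) * cosh (l * infdist s A)"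
    proof (rule tendsto_lowerbound)
      show "((\<lambda>r. cosh (l * (2 * M)) * cosh (l * r)) \<longlongrightarrow>
          cosh (l * (2 * M)) * cosh (l * infdist s A)) (at_right (infdist s A))"
        by (intro tendsto_intros)
      show "\<forall>\<^sub>F r in at_right (infdist s A).
          expectation (\<lambda>\<omega>. dist_cosh l K B (s + X \<omega>)) \<le> cosh (l * (2 * M)) * cosh (l * r)"
        using bound by (auto simp: eventually_at_filter)
    qed simp
    then show ?thesis using True by (simp add: dist_cosh_def)
  qed
qed

end

subsection \<open>Recursion over the independent sequence\<close>

text \<open>The set \<open>T i\<close> of the overview, left unnormalised so that each step of the
  recursion adds one mean set; \<open>avg_mean_set_eq\<close> restores the factor
  \<open>1 / n\<close>.\<close>

definition sum_mean_set ::
    "'w::metric_space measure set \<Rightarrow> (('w \<Rightarrow> real) \<Rightarrow> real) \<Rightarrow> (nat \<Rightarrow> 'w \<Rightarrow> 'b::real_inner) \<Rightarrow> nat \<Rightarrow> 'b set"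
  where
  "sum_mean_set \<P> E X i = {(\<Sum>j=1..i. \<theta> j) | \<theta>. \<forall>j\<in>{1..i}. \<theta> j \<in> mean_set \<P> E (X j)}"

lemma sum_mean_set_0: "sum_mean_set \<P> E X 0 = {0}"
  by (simp add: sum_mean_set_def)

lemma sum_mean_set_Suc:
  assumes "a \<in> sum_mean_set \<P> E X i" "\<theta> \<in> mean_set \<P> E (X (Suc i))"
  shows "a + \<theta> \<in> sum_mean_set \<P> E X (Suc i)"
proof -
  obtain \<eta> where \<eta>: "a = (\<Sum>j=1..i. \<eta> j)" "\<forall>j\<in>{1..i}. \<eta> j \<in> mean_set \<P> E (X j)"
    using assms(1) by (auto simp: sum_mean_set_def)
  have "a + \<theta> = (\<Sum>j=1..Suc i. (\<eta>(Suc i := \<theta>)) j)"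
    unfolding \<eta>(1) by (subst sum.cl_ivl_Suc) (auto intro!: sum.cong)
  moreover have "\<forall>j\<in>{1..Suc i}. (\<eta>(Suc i := \<theta>)) j \<in> mean_set \<P> E (X j)"
    using \<eta>(2) assms(2) by (auto simp: le_Suc_eq)
  ultimately show ?thesis unfolding sum_mean_set_def by blast
qed

lemma avg_mean_set_eq: "avg_mean_set \<P> E n X = (\<lambda>v. (1 / real n) *\<^sub>R v) ` sum_mean_set \<P> E X n"
  unfolding avg_mean_set_def sum_mean_set_def by blast

lemma indep_seqD:
  assumes "indep_seq \<P> E n X" "i \<in> {1..<n}" "\<psi> \<in> tuple_bLip (i + 1)"
  shows "extend \<P> E (\<lambda>\<omega>. \<psi> (\<lambda>j. X j \<omega>)) =
    extend \<P> E (\<lambda>\<omega>. extend \<P> E (\<lambda>\<omega>'. \<psi> ((\<lambda>j. X j \<omega>)(i + 1 := X (i + 1) \<omega>'))))"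
  using assms unfolding indep_seq_def by blast

lemma tuple_bLip_sum:
  fixes h :: "'b::euclidean_space \<Rightarrow> real"
  assumes h: "L-lipschitz_on UNIV h" "bounded (range h)"
  shows "(\<lambda>x. h (\<Sum>j=1..m. x j)) \<in> tuple_bLip m"
proof -
  have L: "L \<ge> 0" using h lipschitz_on_nonneg by blast
  have "\<bar>h (\<Sum>j=1..m. x j) - h (\<Sum>j=1..m. y j)\<bar> \<le> L * m * L2_set (\<lambda>j. dist (x j) (y j)) {1..m}" for x y
  proof -
    have "\<bar>h (\<Sum>j=1..m. x j) - h (\<Sum>j=1..m. y j)\<bar> \<le> L * norm (\<Sum>j=1..m. x j - y j)"
      using lipschitz_onD[OF h(1), of "\<Sum>j=1..m. x j" "\<Sum>j=1..m. y j"]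
      by (simp add: dist_norm sum_subtractf)
    \<comment> \<open>Each of the \<open>m\<close> distances is at most their Euclidean combination,
      whence the factor \<open>m\<close> in the Lipschitz constant.\<close>
    also have "norm (\<Sum>j=1..m. x j - y j) \<le> (\<Sum>j=1..m. L2_set (\<lambda>j. dist (x j) (y j)) {1..m})"
      unfolding dist_norm by (rule sum_norm_le) (rule member_le_L2_set; simp)
    finally show ?thesis using L by (simp add: mult_left_mono mult.assoc)
  qed
  moreover have "bounded (range (\<lambda>x. h (\<Sum>j=1..m. x j)))"
    by (rule bounded_subset[OF h(2)]) auto
  ultimately show ?thesis unfolding tuple_bLip_def by blast
qed

lemma dist_cosh_bounded: "l \<ge> 0 \<Longrightarrow> K \<ge> 0 \<Longrightarrow> bounded (range (dist_cosh l K A))"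
  by (auto simp: bounded_iff dist_cosh_nonneg intro!: exI[of _ "cosh (l * K)"] dist_cosh_le)

context sublinear_representation
begin

lemma sum_vec_Lspace:
  fixes X :: "nat \<Rightarrow> 'w \<Rightarrow> real ^ 'd"
  assumes "\<And>j. j \<in> {1..i} \<Longrightarrow> X j \<in> vec_Lspace \<P> 1"
  shows "(\<lambda>\<omega>. \<Sum>j=1..i. X j \<omega>) \<in> vec_Lspace \<P> 1"
  using assms
proof (induction i)
  case 0
  have "upper_moment \<P> 1 (\<lambda>_. 0) (\<lambda>_. 0) = 0" using ne by (simp add: upper_moment_def)
  moreover have "(\<lambda>_. 0) \<in> bLip" using lipschitz_on_constant by (auto simp: bLip_def)
  ultimately show ?case by (auto simp: vec_Lspace_def Lspace_def intro!: exI[of _ "\<lambda>_ _. 0"])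
next
  case (Suc i)
  then show ?case by (auto simp: intro!: vec_Lspace_1_add subset)
qed

text \<open>A supremum of functions with a common Lipschitz constant keeps that constant. This
  places the inner expectation of the independence identity, evaluated at the partial sum, in
  \<open>Lspace \<P> 1\<close>, where \<open>extend\<close> is a supremum of integrals.\<close>

lemma extend_dist_cosh_lipschitz:
  fixes X :: "'w \<Rightarrow> real ^ 'd"
  assumes X: "X \<in> vec_Lspace \<P> 1" and l: "l \<ge> 0" and K: "K \<ge> 0"
  shows "(sinh (l * K) * l)-lipschitz_on UNIV (\<lambda>s. extend \<P> E (\<lambda>\<omega>. dist_cosh l K B (s + X \<omega>)))"
proof (rule lipschitz_onI)
  let ?L = "sinh (l * K) * l"
  have le: "extend \<P> E (\<lambda>\<omega>. dist_cosh l K B (s + X \<omega>)) \<le>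
      extend \<P> E (\<lambda>\<omega>. dist_cosh l K B (s' + X \<omega>)) + ?L * dist s s'" for s s'
  proof (rule extend_le[OF dist_cosh_shift_Lspace[OF X l K]])
    fix P assume P: "P \<in> \<P>"
    interpret prob_space P by (rule prob[OF P])
    have ih: "integrable P (\<lambda>\<omega>. dist_cosh l K B (s + X \<omega>))" for s
    proof -
      have "(\<lambda>\<omega>. dist_cosh l K B (s + X \<omega>)) \<in> borel_measurable P"
        using dist_cosh_shift_Lspace[OF X l K, of B s] by (intro measurable[OF P]) (auto simp: Lspace_def)
      then show ?thesis
        by (intro integrable_const_bound[of _ "cosh (l * K)"] AE_I2)
           (simp_all add: dist_cosh_nonneg dist_cosh_le[OF l K])
    qed
    have "expectation (\<lambda>\<omega>. dist_cosh l K B (s + X \<omega>)) \<le>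
        expectation (\<lambda>\<omega>. dist_cosh l K B (s' + X \<omega>) + ?L * dist s s')"
    proof (rule integral_mono[OF ih])
      show "dist_cosh l K B (s + X \<omega>) \<le> dist_cosh l K B (s' + X \<omega>) + ?L * dist s s'" for \<omega>
        using lipschitz_onD[OF dist_cosh_lipschitz[OF l K, of B], of "s + X \<omega>" "s' + X \<omega>"]
        by (simp add: dist_real_def)
    qed (use ih in simp)
    also have "\<dots> = expectation (\<lambda>\<omega>. dist_cosh l K B (s' + X \<omega>)) + ?L * dist s s'"
      using ih by (simp add: prob_space)
    also have "expectation (\<lambda>\<omega>. dist_cosh l K B (s' + X \<omega>)) \<le>
        extend \<P> E (\<lambda>\<omega>. dist_cosh l K B (s' + X \<omega>))"
      by (rule le_extend[OF dist_cosh_shift_Lspace[OF X l K] _ P, of _ _ "cosh (l * K)"])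
         (simp add: dist_cosh_nonneg dist_cosh_le[OF l K])
    finally show "expectation (\<lambda>\<omega>. dist_cosh l K B (s + X \<omega>)) \<le>
      extend \<P> E (\<lambda>\<omega>. dist_cosh l K B (s' + X \<omega>)) + ?L * dist s s'" by simp
  qed
  show "dist (extend \<P> E (\<lambda>\<omega>. dist_cosh l K B (s + X \<omega>)))
      (extend \<P> E (\<lambda>\<omega>. dist_cosh l K B (s' + X \<omega>))) \<le> ?L * dist s s'" for s s'
    using le[of s s'] le[of s' s] by (simp add: dist_real_def dist_commute abs_le_iff)
qed (use l K in auto)

text \<open>Nonemptiness is carried through the induction because the one-step bound picks a point
  of the previous set. The induction starts at 1, where the independence identities begin.\<close>

lemma extend_dist_cosh_sum_le:
  fixes X :: "nat \<Rightarrow> 'w \<Rightarrow> real ^ 'd"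
  assumes X: "\<And>i. i \<in> {1..n} \<Longrightarrow> X i \<in> vec_Lspace \<P> 1" and indep: "indep_seq \<P> E n X"
    and M: "\<And>i Q. i \<in> {1..n} \<Longrightarrow> Q \<in> \<P> \<Longrightarrow> AE \<omega> in Q. norm (X i \<omega>) \<le> M"
    and l: "l \<ge> 0" and K: "K \<ge> 0" and i: "1 \<le> i" "i \<le> n"
  shows "sum_mean_set \<P> E X i \<noteq> {} \<and>
    extend \<P> E (\<lambda>\<omega>. dist_cosh l K (sum_mean_set \<P> E X i) (\<Sum>j=1..i. X j \<omega>)) \<le> cosh (l * (2 * M)) ^ i"
  using i
proof (induction i rule: nat_induct_at_least)
  case base
  obtain P where P: "P \<in> \<P>" using ne by blast
  have 1: "1 \<in> {1..n}" using base by simp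
  have "integral\<^sup>L P (X 1) \<in> mean_set \<P> E (X 1)" by (rule mean_in_mean_set[OF X[OF 1] M[OF 1] P])
  then have ne1: "sum_mean_set \<P> E X 1 \<noteq> {}"
    using sum_mean_set_Suc[of 0 \<P> E X 0] by (auto simp: sum_mean_set_0)
  \<comment> \<open>The one-step bound from \<open>s = 0\<close> and \<open>A = {0}\<close>, where
    \<open>dist_cosh\<close> equals \<open>cosh 0 = 1\<close>.\<close>
  have "extend \<P> E (\<lambda>\<omega>. dist_cosh l K (sum_mean_set \<P> E X 1) (0 + X 1 \<omega>)) \<le>
      cosh (l * (2 * M)) * dist_cosh l K {0 :: real ^ 'd} 0"
    using sum_mean_set_Suc[of _ \<P> E X 0]
    by (intro extend_dist_cosh_le[OF X[OF 1] M[OF 1] _ _ l K]) (auto simp: sum_mean_set_0)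
  then show ?case using ne1 K by (simp add: dist_cosh_def)
next
  case (Suc i)
  let ?C = "cosh (l * (2 * M))" and ?T = "sum_mean_set \<P> E X"
  define S where "S \<omega> = (\<Sum>j=1..i. X j \<omega>)" for \<omega>
  \<comment> \<open>The inner expectation of the independence identity, with the partial sum frozen
    at \<open>s\<close>.\<close>
  define g where "g s = extend \<P> E (\<lambda>\<omega>'. dist_cosh l K (?T (Suc i)) (s + X (Suc i) \<omega>'))" for s
  have i: "i \<in> {1..<n}" "Suc i \<in> {1..n}" using Suc.hyps Suc.prems by auto
  have IH: "?T i \<noteq> {}" "extend \<P> E (\<lambda>\<omega>. dist_cosh l K (?T i) (S \<omega>)) \<le> ?C ^ i"
    using Suc.IH i by (auto simp: S_def)
  obtain P where P: "P \<in> \<P>" using ne by blast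
  have "integral\<^sup>L P (X (Suc i)) \<in> mean_set \<P> E (X (Suc i))"
    by (rule mean_in_mean_set[OF X[OF i(2)] M[OF i(2)] P])
  then have neS: "?T (Suc i) \<noteq> {}" using IH(1) sum_mean_set_Suc by blast
  have S: "S \<in> vec_Lspace \<P> 1"
    unfolding S_def using i by (intro sum_vec_Lspace X) auto
  have g_lip: "(sinh (l * K) * l)-lipschitz_on UNIV g"
    unfolding g_def by (rule extend_dist_cosh_lipschitz[OF X[OF i(2)] l K])
  have g_le: "g s \<le> ?C * dist_cosh l K (?T i) s" for s
    unfolding g_def by (rule extend_dist_cosh_le[OF X[OF i(2)] M[OF i(2)] IH(1) sum_mean_set_Suc l K])
  have h_Lspace: "(\<lambda>\<omega>. dist_cosh l K (?T i) (S \<omega>)) \<in> Lspace \<P> 1"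
    by (rule lipschitz_comp_Lspace_1[OF subset S dist_cosh_lipschitz[OF l K]])
  have "extend \<P> E (\<lambda>\<omega>. dist_cosh l K (?T (Suc i)) (\<Sum>j=1..Suc i. X j \<omega>)) = extend \<P> E (\<lambda>\<omega>. g (S \<omega>))"
  proof -
    have "extend \<P> E (\<lambda>\<omega>. dist_cosh l K (?T (Suc i)) (\<Sum>j=1..i + 1. X j \<omega>)) =
        extend \<P> E (\<lambda>\<omega>. extend \<P> E (\<lambda>\<omega>'. dist_cosh l K (?T (Suc i))
          (\<Sum>j=1..i + 1. ((\<lambda>j. X j \<omega>)(i + 1 := X (i + 1) \<omega>')) j)))"
      using indep_seqD[OF indep i(1) tuple_bLip_sum[OF dist_cosh_lipschitz[OF l K] dist_cosh_bounded[OF l K]]] .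
    \<comment> \<open>Overwriting entry \<open>i + 1\<close> leaves the first \<open>i\<close>
      summands at the outer sample point, so the test function sees only their sum and the new
      vector.\<close>
    moreover have "(\<Sum>j=1..i + 1. ((\<lambda>j. X j \<omega>)(i + 1 := X (i + 1) \<omega>')) j) = S \<omega> + X (Suc i) \<omega>'" for \<omega> \<omega>'
      unfolding S_def Suc_eq_plus1[symmetric] by (subst sum.cl_ivl_Suc) (auto intro!: sum.cong)
    ultimately show ?thesis by (simp add: g_def)
  qed
  also have "\<dots> \<le> ?C * ?C ^ i"
  proof (rule extend_le[OF lipschitz_comp_Lspace_1[OF subset S g_lip]])
    fix P assume P: "P \<in> \<P>"
    interpret prob_space P by (rule prob[OF P])
    have "integrable P (\<lambda>\<omega>. dist_cosh l K (?T i) (S \<omega>))"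
      using h_Lspace by (intro integrable_const_bound[of _ "cosh (l * K)"] AE_I2 measurable[OF P])
        (simp_all add: dist_cosh_nonneg dist_cosh_le[OF l K] Lspace_def)
    then have "expectation (\<lambda>\<omega>. g (S \<omega>)) \<le> expectation (\<lambda>\<omega>. ?C * dist_cosh l K (?T i) (S \<omega>))"
      using g_le by (intro integral_mono') (auto simp: dist_cosh_nonneg)
    also have "\<dots> = ?C * expectation (\<lambda>\<omega>. dist_cosh l K (?T i) (S \<omega>))" by simp
    also have "\<dots> \<le> ?C * extend \<P> E (\<lambda>\<omega>. dist_cosh l K (?T i) (S \<omega>))"
      by (intro mult_left_mono le_extend[OF h_Lspace _ P, of "cosh (l * K)"])
         (simp_all add: dist_cosh_nonneg dist_cosh_le[OF l K])
    also have "\<dots> \<le> ?C * ?C ^ i" by (intro mult_left_mono IH) simp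
    finally show "expectation (\<lambda>\<omega>. g (S \<omega>)) \<le> ?C * ?C ^ i" .
  qed
  finally show ?case using neS by simp
qed

section \<open>Exponential Markov inequality for the upper capacity\<close>

lemma upper_capacity_le:
  fixes X :: "nat \<Rightarrow> 'w \<Rightarrow> real ^ 'd"
  assumes n: "n \<ge> 1" and X: "\<And>i. i \<in> {1..n} \<Longrightarrow> X i \<in> vec_Lspace \<P> 1"
    and indep: "indep_seq \<P> E n X" and M0: "M > 0"
    and M: "\<And>i Q. i \<in> {1..n} \<Longrightarrow> Q \<in> \<P> \<Longrightarrow> AE \<omega> in Q. norm (X i \<omega>) \<le> M"
    and t: "t > 0"
  shows "upper_capacity \<P>
      {\<omega>. infdist ((1 / real n) *\<^sub>R (\<Sum>i=1..n. X i \<omega>)) (avg_mean_set \<P> E n X) > t}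
    \<le> 2 * exp (- (real n * t\<^sup>2 / (8 * M\<^sup>2)))"
proof -
  \<comment> \<open>This \<open>l\<close> minimises the final exponent
    \<open>2 * n * l\<^sup>2 * M\<^sup>2 - l * n * t\<close>, with minimum
    \<open>- n * t\<^sup>2 / (8 * M\<^sup>2)\<close>.\<close>
  define l where "l = t / (4 * M\<^sup>2)"
  define K where "K = real n * t"
  define S where "S \<omega> = (\<Sum>i=1..n. X i \<omega>)" for \<omega>
  let ?T = "sum_mean_set \<P> E X n"
  let ?A = "{\<omega>. infdist ((1 / real n) *\<^sub>R S \<omega>) (avg_mean_set \<P> E n X) > t}"
  have l: "l \<ge> 0" and K: "K \<ge> 0" using M0 t by (auto simp: l_def K_def)
  have T: "?T \<noteq> {}"
    and ext: "extend \<P> E (\<lambda>\<omega>. dist_cosh l K ?T (S \<omega>)) \<le> cosh (l * (2 * M)) ^ n"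
    using extend_dist_cosh_sum_le[OF X indep M l K n] by (auto simp: S_def)
  have S: "S \<in> vec_Lspace \<P> 1" unfolding S_def using X by (intro sum_vec_Lspace) auto
  have h_Lspace: "(\<lambda>\<omega>. dist_cosh l K ?T (S \<omega>)) \<in> Lspace \<P> 1"
    by (rule lipschitz_comp_Lspace_1[OF subset S dist_cosh_lipschitz[OF l K]])
  \<comment> \<open>Scaling by \<open>n\<close> turns the event into a distance of at least
    \<open>K = n * t\<close> from the sum to \<open>?T\<close>, so the truncated function takes its
    maximal value there.\<close>
  have A: "dist_cosh l K ?T (S \<omega>) = cosh (l * K)" if "\<omega> \<in> ?A" for \<omega>
  proof -
    have "K \<le> infdist (S \<omega>) ?T"
      unfolding infdist_notempty[OF T]
    proof (rule cINF_greatest[OF T])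
      fix a assume "a \<in> ?T"
      then have a: "(1 / real n) *\<^sub>R a \<in> avg_mean_set \<P> E n X" by (auto simp: avg_mean_set_eq)
      have "t < dist ((1 / real n) *\<^sub>R S \<omega>) ((1 / real n) *\<^sub>R a)"
        using that infdist_le[OF a, of "(1 / real n) *\<^sub>R S \<omega>"] unfolding mem_Collect_eq by linarith
      also have "\<dots> = dist (S \<omega>) a / real n"
        by (simp add: dist_norm flip: scaleR_right_diff_distrib)
      finally show "K \<le> dist (S \<omega>) a" using n by (simp add: K_def field_simps)
    qed
    then show ?thesis by (simp add: dist_cosh_def min_def)
  qed
  have "measure P ?A \<le> 2 * exp (- (real n * t\<^sup>2 / (8 * M\<^sup>2)))" if P: "P \<in> \<P>" for P
  proof -
    interpret prob_space P by (rule prob[OF P])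
    have [measurable]: "S \<in> borel_measurable P"
      by (rule measurable[OF P vec_Lspace_measurable[OF S]])
    have int: "integrable P (\<lambda>\<omega>. dist_cosh l K ?T (S \<omega>))"
      using h_Lspace by (intro integrable_const_bound[of _ "cosh (l * K)"] AE_I2 measurable[OF P])
        (simp_all add: dist_cosh_nonneg dist_cosh_le[OF l K] Lspace_def)
    have "(\<lambda>v. infdist ((1 / real n) *\<^sub>R v) (avg_mean_set \<P> E n X)) \<in> borel_measurable borel"
      by (intro borel_measurable_continuous_onI continuous_intros)
    then have [measurable]:
      "(\<lambda>\<omega>. infdist ((1 / real n) *\<^sub>R S \<omega>) (avg_mean_set \<P> E n X)) \<in> borel_measurable P"
      by (rule measurable_compose[rotated]) measurable
    have sp: "space P = UNIV" using sets_eq_imp_space_eq[OF sets[OF P]] by simp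
    have "?A = {\<omega> \<in> space P. infdist ((1 / real n) *\<^sub>R S \<omega>) (avg_mean_set \<P> E n X) > t}"
      by (simp add: sp)
    also have "\<dots> \<in> sets P" by measurable
    finally have "measure P ?A * cosh (l * K) = expectation (\<lambda>\<omega>. indicator ?A \<omega> * cosh (l * K))"
      by simp
    also have "\<dots> \<le> expectation (\<lambda>\<omega>. dist_cosh l K ?T (S \<omega>))"
      using A by (intro integral_mono' int) (auto simp: indicator_def dist_cosh_nonneg)
    also have "\<dots> \<le> extend \<P> E (\<lambda>\<omega>. dist_cosh l K ?T (S \<omega>))"
      by (intro le_extend[OF h_Lspace _ P, of "cosh (l * K)"])
         (simp add: dist_cosh_nonneg dist_cosh_le[OF l K])
    also have "\<dots> \<le> exp ((l * (2 * M))\<^sup>2 / 2) ^ n"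
      using ext by (rule order_trans) (intro power_mono cosh_le_exp_half_square, simp)
    \<comment> \<open>The bound \<open>cosh x \<ge> exp x / 2\<close> is the source of the factor 2
      in the result.\<close>
    finally have "measure P ?A * (exp (l * K) / 2) \<le> exp ((l * (2 * M))\<^sup>2 / 2) ^ n"
      by (rule order_trans[rotated]) (intro mult_left_mono, simp_all add: cosh_field_def)
    then have "measure P ?A \<le> 2 * (exp ((l * (2 * M))\<^sup>2 / 2) ^ n * exp (- (l * K)))"
      by (simp add: exp_minus field_simps)
    also have "exp ((l * (2 * M))\<^sup>2 / 2) ^ n * exp (- (l * K)) = exp (real n * ((l * (2 * M))\<^sup>2 / 2) - l * K)"
      by (simp add: exp_diff exp_minus exp_of_nat_mult field_simps)
    also have "real n * ((l * (2 * M))\<^sup>2 / 2) - l * K = - (real n * t\<^sup>2 / (8 * M\<^sup>2))"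
      using M0 by (simp add: l_def K_def power2_eq_square field_simps)
    finally show ?thesis .
  qed
  then show ?thesis
    unfolding upper_capacity_def S_def[symmetric] by (intro cSUP_least ne)
qed

end

text \<open>Over an empty set the supremum would be the same for every function, whereas
  \<open>E\<close> separates the constants 0 and 1.\<close>

lemma representing_set_nonempty:
  fixes E :: "('w::metric_space \<Rightarrow> real) \<Rightarrow> real"
  assumes "regular_sublinear_expectation E" "representing_set E \<P>"
  shows "\<P> \<noteq> {}"
proof
  assume "\<P> = {}"
 moreover have "(\<lambda>_::'w. c) \<in> bLip" for c
    using lipschitz_on_constant by (auto simp: bLip_def)
  ultimately have "E (\<lambda>_. 0) = E (\<lambda>_. 1)"
    using assms(2) by (simp add: representing_set_def)
  moreover have "E (\<lambda>_. c) = c" for c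
    using assms(1) by (simp add: regular_sublinear_expectation_def)
  ultimately show False by simp
qed

theorem corollary4p2:
  fixes E :: "('w::polish_space \<Rightarrow> real) \<Rightarrow> real"
    and \<P> :: "'w measure set"
    and X :: "nat \<Rightarrow> 'w \<Rightarrow> real ^ 'd"
    and n :: nat and M t :: real
  assumes "regular_sublinear_expectation E"
    and "representing_set E \<P>"
    and "n \<ge> 1"
    and "\<And>i k. i \<in> {1..n} \<Longrightarrow> (\<lambda>\<omega>. X i \<omega> $ k) \<in> Lspace \<P> 2"
    and "indep_seq \<P> E n X"
    and "M > 0"
    and "\<And>i P. i \<in> {1..n} \<Longrightarrow> P \<in> \<P> \<Longrightarrow> AE \<omega> in P. norm (X i \<omega>) \<le> M"
    and "t > 0"
  shows "upper_capacity \<P>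
           {\<omega>. infdist ((1 / real n) *\<^sub>R (\<Sum>i=1..n. X i \<omega>)) (avg_mean_set \<P> E n X) > t}
         \<le> 2 * 5 ^ CARD('d) * exp (- (real n * t\<^sup>2 / (32 * M\<^sup>2)))"
proof -
  interpret sublinear_representation E \<P>
    using assms(1,2) representing_set_nonempty by unfold_locales
  have X: "X i \<in> vec_Lspace \<P> 1" if "i \<in> {1..n}" for i
    using assms(4)[OF that] by (auto simp: vec_Lspace_def intro: Lspace_2_imp_1[OF subset])
  \<comment> \<open>The bound from \<open>upper_capacity_le\<close> has the better exponent and no
    dimensional factor; both are relaxed to the stated form.\<close>
  have "real n * t\<^sup>2 / (32 * M\<^sup>2) \<le> real n * t\<^sup>2 / (8 * M\<^sup>2)"
    using assms(6) by (intro divide_left_mono) auto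
  moreover have "(1::real) \<le> 5 ^ CARD('d)" by simp
  ultimately have "1 * exp (- (real n * t\<^sup>2 / (8 * M\<^sup>2))) \<le>
      5 ^ CARD('d) * exp (- (real n * t\<^sup>2 / (32 * M\<^sup>2)))"
    by (intro mult_mono) auto
  then show ?thesis
    using upper_capacity_le[OF assms(3) X assms(5-8)] by linarith
qed

end
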